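(* For all positive integers $m$ and $n$, $$S_{m,n}(\mathbf{x};y)=C_{m,n}(\mathbf{x}+y),$$ where $S_{m,n}(\mathbf{x};y)$ is the symmetric function enumerator of $(m,n)$-Schröder paths and $C_{m,n}(\mathbf{x})$ is the symmetric function enumerator of $(m,n)$-Dyck paths.
   Context: For positive integers $m,n$, an $(m,n)$-Schröder path is a sequence of points $(u,v)\in\mathbb{N}\times\mathbb{N}$ starting at $(0,0)$ and ending at $(m,n)$, all satisfying $mv-nu\geq 0$, in which each next point is obtained by adding $(0,1)$ (up step), $(1,1)$ (diagonal step) or $(1,0)$ (right step). For such a path $\alpha$, $\mathrm{diag}(\alpha)$ is the number of its diagonal steps, and $\gamma(\alpha)$ is the list of the lengths of its risers, i.e. of its maximal sequences of consecutive up steps. An $(m,n)$-Dyck path is an $(m,n)$-Schröder path with $\mathrm{diag}(\alpha)=0$. The elementary symmetric functions in $\mathbf{x}=x_1,x_2,x_3,\ldots$ are given by $\sum_{k\geq0}e_k(\mathbf{x})z^k=\prod_{i\geq1}(1+x_iz)$, so $e_0=1$. The weight of a path is $\alpha(\mathbf{x}):=\prod_{k\in\gamma(\alpha)}e_k(\mathbf{x})$ (product with multiplicity, equal to $1$ if there is no riser). Then $$S_{m,n}(\mathbf{x};y):=\sum_{\alpha}\alpha(\mathbf{x})\,y^{\mathrm{diag}(\alpha)},\qquad C_{m,n}(\mathbf{x}):=\sum_{\mathrm{diag}(\alpha)=0}\alpha(\mathbf{x}),$$ the sums being over $(m,n)$-Schröder paths $\alpha$ (with no diagonal step in the second case). For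 a symmetric function $f(\mathbf{x})$, $f(\mathbf{x}+y)$ denotes $f$ evaluated on the set of variables $\mathbf{x}$ enlarged by one new variable $y$; in particular $e_k(\mathbf{x}+y)=e_k(\mathbf{x})+e_{k-1}(\mathbf{x})\,y$ for $k\geq 1$. *)

theory Defs
  imports
    Complex_Main
    "HOL-Library.Multiset"
    "HOL-Library.Product_Plus"
    "HOL-Computational_Algebra.Polynomial"
begin

section \<open>Formal power series in an arbitrary set of variables\<close>

text \<open>
  A monomial in the variables \<open>'v\<close> is a finite multiset of variables. The type \<open>'v\<close> may be
  infinite, so symmetric functions in \<open>x\<^sub>1, x\<^sub>2, \<dots>\<close> are elements of \<open>nat series\<close>,
  with \<open>var i\<close> for \<open>i :: nat\<close> standing for the variable of index \<open>i + 1\<close>.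
\<close>

typedef 'v series = "UNIV :: ('v multiset \<Rightarrow> int) set"
  morphisms mcoeff Abs_series ..

setup_lifting type_definition_series

lemma series_eqI: "(\<And>M. mcoeff f M = mcoeff g M) \<Longrightarrow> f = g"
  by (metis ext mcoeff_inject)

lemma double_diff_mset: "A \<subseteq># M \<Longrightarrow> M - (M - A) = (A :: 'a multiset)"
  by (rule multiset_eqI) (simp add: mset_subset_eq_count)

lemma finite_subset_mset [simp]: "finite {A. A \<subseteq># M}"
proof (induction M)
  case empty
  then show ?case by simp
next
  case (add x M)
  have "{A. A \<subseteq># add_mset x M} \<subseteq> {A. A \<subseteq># M} \<union> add_mset x ` {A. A \<subseteq># M}"
  proof
    fix A assume A: "A \<in> {A. A \<subseteq># add_mset x M}"
    show "A \<in> {A. A \<subseteq># M} \<union> add_mset x ` {A. A \<subseteq># M}"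
    proof (cases "x \<in># A")
      case True
      then obtain B where "A = add_mset x B" by (metis multi_member_split)
      then show ?thesis using A by auto
    next
      case False
      have "count A a \<le> count M a" for a
        using A False by (cases "a = x") (auto simp: subseteq_mset_def not_in_iff dest: spec[of _ a])
      then have "A \<subseteq># M" by (simp add: subseteq_mset_def)
      then show ?thesis by simp
    qed
  qed
  then show ?case using add finite_subset by blast
qed

instantiation series :: (type) comm_ring_1
begin

lift_definition zero_series :: "'a series" is "\<lambda>_. 0" .
lift_definition one_series :: "'a series" is "\<lambda>M. if M = {#} then 1 else 0" .
lift_definition plus_series :: "'a series \<Rightarrow> 'a series \<Rightarrow> 'a series" is "\<lambda>f g M. f M + g M" .
lift_definition minus_series :: "'a series \<Rightarrow> 'a series \<Rightarrow> 'a series" is "\<lambda>f g M. f M - g M" .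
lift_definition uminus_series :: "'a series \<Rightarrow> 'a series" is "\<lambda>f M. - f M" .
lift_definition times_series :: "'a series \<Rightarrow> 'a series \<Rightarrow> 'a series"
  is "\<lambda>f g M. \<Sum>A | A \<subseteq># M. f A * g (M - A)" .

instance
proof
  fix a b c :: "'a series"
  show "a * b * c = a * (b * c)"
  proof (rule series_eqI)
    fix M :: "'a multiset"
    have "mcoeff (a * b * c) M = (\<Sum>A | A \<subseteq># M. \<Sum>B | B \<subseteq># A.
        mcoeff a B * mcoeff b (A - B) * mcoeff c (M - A))"
      by (simp add: times_series.rep_eq sum_distrib_right)
    also have "\<dots> = (\<Sum>(A, B) \<in> (SIGMA A : {A. A \<subseteq># M}. {B. B \<subseteq># A}).
        mcoeff a B * mcoeff b (A - B) * mcoeff c (M - A))"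
      by (subst sum.Sigma) auto
    also have "\<dots> = (\<Sum>(B, C) \<in> (SIGMA B : {B. B \<subseteq># M}. {C. C \<subseteq># M - B}).
        mcoeff a B * (mcoeff b C * mcoeff c (M - B - C)))"
    proof (rule sum.reindex_bij_witness[where i = "\<lambda>(B, C). (B + C, B)" and
          j = "\<lambda>(A, B). (B, A - B)"])
      fix p assume p: "p \<in> (SIGMA A : {A. A \<subseteq># M}. {B. B \<subseteq># A})"
      obtain A B where [simp]: "p = (A, B)" by (cases p)
      have AB: "A \<subseteq># M" "B \<subseteq># A" using p by auto
      have eq: "B + (A - B) = A" using AB by simp
      show "(case (case p of (A, B) \<Rightarrow> (B, A - B)) of (B, C) \<Rightarrow> (B + C, B)) = p"
        using AB by simp
      show "(case p of (A, B) \<Rightarrow> (B, A - B)) \<in> (SIGMA B : {B. B \<subseteq># M}. {C. C \<subseteq># M - B})"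
        using AB
        by (auto intro: subset_mset.order_trans simp: subset_eq_diff_conv)
      have "M - B - (A - B) = M - A" using eq by (metis diff_diff_add)
      then show "(case case p of (A, B) \<Rightarrow> (B, A - B) of
          (B, C) \<Rightarrow> mcoeff a B * (mcoeff b C * mcoeff c (M - B - C))) =
         (case p of (A, B) \<Rightarrow> mcoeff a B * mcoeff b (A - B) * mcoeff c (M - A))"
        by (simp add: mult.assoc)
    next
      fix p assume p: "p \<in> (SIGMA B : {B. B \<subseteq># M}. {C. C \<subseteq># M - B})"
      obtain B C where [simp]: "p = (B, C)" by (cases p)
      have BC: "B \<subseteq># M" "C \<subseteq># M - B" using p by auto
      show "(case (case p of (B, C) \<Rightarrow> (B + C, B)) of (A, B) \<Rightarrow> (B, A - B)) = p" by simp
      have "B + C \<subseteq># M" using BC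
        by (metis subset_mset.add_diff_inverse subset_mset.add_left_mono)
      then show "(case p of (B, C) \<Rightarrow> (B + C, B)) \<in> (SIGMA A : {A. A \<subseteq># M}. {B. B \<subseteq># A})"
        by auto
    qed
    also have "\<dots> = (\<Sum>B | B \<subseteq># M. \<Sum>C | C \<subseteq># M - B.
        mcoeff a B * (mcoeff b C * mcoeff c (M - B - C)))"
      by (subst sum.Sigma) auto
    also have "\<dots> = mcoeff (a * (b * c)) M"
      by (simp add: times_series.rep_eq sum_distrib_left)
    finally show "mcoeff (a * b * c) M = mcoeff (a * (b * c)) M" .
  qed
  show "a * b = b * a"
  proof (rule series_eqI)
    fix M :: "'a multiset"
    show "mcoeff (a * b) M = mcoeff (b * a) M"
      unfolding times_series.rep_eq
    proof (rule sum.reindex_bij_witness[where i = "\<lambda>A. M - A" and j = "\<lambda>A. M - A"])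
      fix A :: "'a multiset" assume "A \<in> {A. A \<subseteq># M}"
      then have A: "A \<subseteq># M" by simp
      show *: "M - (M - A) = A" using A by (simp add: double_diff_mset)
      show "M - A \<in> {A. A \<subseteq># M}" by simp
      show "mcoeff b (M - A) * mcoeff a (M - (M - A)) = mcoeff a A * mcoeff b (M - A)"
        using * by simp
    next
      fix A assume "A \<in> {A. A \<subseteq># M}"
      then show "M - (M - A) = A" "M - A \<in> {A. A \<subseteq># M}" by (simp_all add: double_diff_mset)
    qed
  qed
  show "1 * a = a"
  proof (rule series_eqI)
    fix M :: "'a multiset"
    have "mcoeff (1 * a) M = (\<Sum>A | A \<subseteq># M. if A = {#} then mcoeff a M else 0)"
      unfolding times_series.rep_eq one_series.rep_eq by (rule sum.cong) auto
    then show "mcoeff (1 * a) M = mcoeff a M" by simp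
  qed
  show "(a + b) * c = a * c + b * c"
    by (rule series_eqI)
      (simp add: times_series.rep_eq plus_series.rep_eq algebra_simps sum.distrib)
  show "(0 :: 'a series) \<noteq> 1"
    by transfer (metis zero_neq_one)
qed (transfer; simp add: algebra_simps)+

end

lift_definition var :: "'v \<Rightarrow> 'v series" is "\<lambda>i M. if M = {#i#} then 1 else 0" .

text \<open>
  The substitution \<open>x\<^sub>i \<mapsto> x\<^bsub>\<sigma> i\<^esub>\<close>. It is only meaningful if \<open>\<sigma>\<close> has finite fibres; below it
  is used for injective \<open>\<sigma>\<close>, where the sum has at most one term.
\<close>
lift_definition rename :: "('v \<Rightarrow> 'w) \<Rightarrow> 'v series \<Rightarrow> 'w series"
  is "\<lambda>\<sigma> f N. \<Sum>M | image_mset \<sigma> M = N. f M" .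

lemma image_mset_inj:
  assumes "inj \<sigma>" "image_mset \<sigma> A = image_mset \<sigma> B"
  shows "A = B"
  using arg_cong[OF assms(2), of "image_mset (inv \<sigma>)"] assms(1)
  by (simp add: multiset.map_comp)

lemma mcoeff_rename_inj:
  assumes "inj \<sigma>"
  shows "mcoeff (rename \<sigma> f) (image_mset \<sigma> M) = mcoeff f M"
proof -
  have "{M'. image_mset \<sigma> M' = image_mset \<sigma> M} = {M}"
    using image_mset_inj[OF assms] by blast
  then show ?thesis by (simp add: rename.rep_eq)
qed

lemma image_mset_surj:
  assumes "bij \<sigma>"
  shows "\<exists>M. N = image_mset \<sigma> M"
proof
  have "image_mset \<sigma> (image_mset (inv \<sigma>) N) = image_mset (\<lambda>x. x) N"
    unfolding multiset.map_comp
    by (intro image_mset_cong) (simp add: assms bij_is_surj surj_f_inv_f)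
  then show "N = image_mset \<sigma> (image_mset (inv \<sigma>) N)" by simp
qed

lemma rename_rename:
  assumes "bij \<sigma>" "bij \<tau>"
  shows "rename \<tau> (rename \<sigma> f) = rename (\<tau> \<circ> \<sigma>) f"
proof (rule series_eqI)
  fix N
  obtain M where "N = image_mset \<tau> (image_mset \<sigma> M)"
    using image_mset_surj assms by metis
  moreover have "inj \<sigma>" "inj \<tau>" "inj (\<tau> \<circ> \<sigma>)"
    using assms by (auto intro: bij_is_inj inj_compose)
  ultimately show "mcoeff (rename \<tau> (rename \<sigma> f)) N = mcoeff (rename (\<tau> \<circ> \<sigma>) f) N"
    by (metis mcoeff_rename_inj multiset.map_comp)
qed

definition symmetric_series :: "'v series \<Rightarrow> bool" where
  "symmetric_series f \<longleftrightarrow> (\<forall>\<pi>. bij \<pi> \<longrightarrow> rename \<pi> f = f)"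


section \<open>Elementary symmetric functions\<close>

text \<open>
  The coefficient of \<open>z\<^sup>k\<close> in \<open>\<Prod>\<^sub>i (1 + x\<^sub>i z)\<close>. The infinite product is the coefficientwise
  limit of the finite products, which are polynomials in \<open>z\<close>.
\<close>
lift_definition esym :: "nat \<Rightarrow> 'v series"
  is "\<lambda>k M. Lim (finite_subsets_at_top UNIV) (\<lambda>I. mcoeff (coeff (\<Prod>i\<in>I. [:1, var i:]) k) M)" .

lemma mcoeff_var_mult:
  "mcoeff (var i * f) M = (if i \<in># M then mcoeff f (M - {#i#}) else 0)"
proof -
  have "mcoeff (var i * f) M = (\<Sum>A | A \<subseteq># M. if A = {#i#} then mcoeff f (M - {#i#}) else 0)"
    unfolding times_series.rep_eq var.rep_eq by (rule sum.cong) auto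
  then show ?thesis by simp
qed

lemma mcoeff_finite_prod:
  assumes "finite I"
  shows "mcoeff (coeff (\<Prod>i\<in>I. [:1, var i:]) k) M =
    (if \<exists>S \<subseteq> I. card S = k \<and> M = mset_set S then 1 else 0)"
  using assms
proof (induction I arbitrary: k M rule: finite_induct)
  case empty
  then show ?case
    by (auto simp: one_series.rep_eq zero_series.rep_eq coeff_1)
next
  case (insert i I)
  let ?p = "\<Prod>i\<in>I. [:1, var i:]"
  have fin: "finite S" if "S \<subseteq> I" for S using that insert finite_subset by blast
  have step: "coeff ([:1, var i:] * ?p) k =
      coeff ?p k + (case k of 0 \<Rightarrow> 0 | Suc l \<Rightarrow> var i * coeff ?p l)"
    by (cases k) (simp_all add: coeff_pCons)
  have no_i: "i \<notin># mset_set S" if "S \<subseteq> I" for S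
    using that insert fin by auto
  have iff: "(\<exists>S \<subseteq> insert i I. card S = k \<and> M = mset_set S) \<longleftrightarrow>
      (\<exists>S \<subseteq> I. card S = k \<and> M = mset_set S) \<or>
      (\<exists>S \<subseteq> I. Suc (card S) = k \<and> M = add_mset i (mset_set S))" (is "?L \<longleftrightarrow> ?A \<or> ?B")
  proof
    assume ?L
    then obtain S where S: "S \<subseteq> insert i I" "card S = k" "M = mset_set S" by blast
    show "?A \<or> ?B"
    proof (cases "i \<in> S")
      case True
      then have "S - {i} \<subseteq> I" using S by auto
      moreover have "S = insert i (S - {i})" using True by auto
      ultimately have ?B using S fin
        by (intro exI[of _ "S - {i}"]) (metis Diff_iff card_insert_disjoint insertI1 mset_set.insert)
      then show ?thesis ..
    qed (use S in auto)
  next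
    assume "?A \<or> ?B"
    then show ?L
    proof
      assume ?B
      then obtain S where S: "S \<subseteq> I" "Suc (card S) = k" "M = add_mset i (mset_set S)" by blast
      have "i \<notin> S" using S insert by auto
      then show ?L using S fin[OF S(1)] by (intro exI[of _ "insert i S"]) auto
    qed blast
  qed
  have disj: "\<not> (?A \<and> ?B)"
    using no_i by (metis union_single_eq_member)
  show ?case
  proof (cases k)
    case 0
    then show ?thesis
      unfolding prod.insert[OF insert(1,2)] step iff by (simp add: insert.IH plus_series.rep_eq)
  next
    case (Suc l)
    have eq: "M - {#i#} = N \<and> i \<in># M \<longleftrightarrow> M = add_mset i N" for N
      by (metis add_mset_remove_trivial insert_DiffM union_single_eq_member)
    have "(\<exists>S \<subseteq> I. card S = l \<and> M - {#i#} = mset_set S) \<and> i \<in># M \<longleftrightarrow>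
        (\<exists>S \<subseteq> I. Suc (card S) = k \<and> M = add_mset i (mset_set S))"
      using Suc eq by blast
    then show ?thesis
      unfolding prod.insert[OF insert(1,2)] step iff using disj Suc
      by (auto simp: insert.IH plus_series.rep_eq mcoeff_var_mult)
  qed
qed

lemma eventually_finite_prod:
  "\<forall>\<^sub>F I in finite_subsets_at_top UNIV. mcoeff (coeff (\<Prod>i\<in>I. [:1, var i:]) k) M =
    (if \<exists>S. finite S \<and> card S = k \<and> M = mset_set S then 1 else 0)"
  unfolding eventually_finite_subsets_at_top
proof (intro exI[of _ "set_mset M"] conjI allI impI)
  fix I assume I: "finite I \<and> set_mset M \<subseteq> I \<and> I \<subseteq> UNIV"
  have "(\<exists>S \<subseteq> I. card S = k \<and> M = mset_set S) \<longleftrightarrow>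
      (\<exists>S. finite S \<and> card S = k \<and> M = mset_set S)"
    using I by (metis finite_set_mset_mset_set finite_subset)
  then show "mcoeff (coeff (\<Prod>i\<in>I. [:1, var i:]) k) M =
    (if \<exists>S. finite S \<and> card S = k \<and> M = mset_set S then 1 else 0)"
    using mcoeff_finite_prod[of I k M] I by simp
qed auto

lemma mcoeff_esym:
  "mcoeff (esym k) M = (if \<exists>S. finite S \<and> card S = k \<and> M = mset_set S then 1 else 0)"
  unfolding esym.rep_eq
  by (rule tendsto_Lim[OF finite_subsets_at_top_neq_bot]) (rule tendsto_eventually[OF eventually_finite_prod])

lemma esym_0 [simp]: "esym 0 = 1"
  by (rule series_eqI) (auto simp: mcoeff_esym one_series.rep_eq)


section \<open>Adding a new variable\<close>

text \<open>
  The alphabet \<open>x + y\<close> is \<open>nat option\<close>, with \<open>y = var None\<close> and the old variables \<open>var (Some i)\<close>.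
  Evaluation at \<open>x + y\<close> lists the enlarged alphabet as \<open>y, x\<^sub>1, x\<^sub>2, \<dots>\<close>; for symmetric series
  the order is immaterial.
\<close>
definition eval_plus :: "nat series \<Rightarrow> nat option series" where
  "eval_plus = rename (case_nat None Some)"

lemma bij_case_nat_option: "bij (case_nat None Some)"
  by (rule bij_betw_byWitness[where f' = "case_option 0 Suc"]) (auto split: nat.split option.split)

lemma eval_plus_symmetric:
  assumes "symmetric_series f" "bij \<sigma>"
  shows "eval_plus f = rename \<sigma> f"
proof -
  let ?\<tau> = "case_nat None Some :: nat \<Rightarrow> nat option"
  have b: "bij (inv ?\<tau> \<circ> \<sigma>)" using assms bij_case_nat_option bij_comp bij_imp_bij_inv by blast
  have "?\<tau> \<circ> (inv ?\<tau> \<circ> \<sigma>) = \<sigma>"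
    using bij_is_surj[OF bij_case_nat_option] by (auto simp: fun_eq_iff surj_f_inv_f)
  then show ?thesis
    using rename_rename[OF b bij_case_nat_option, of f] assms(1) b
    by (simp add: eval_plus_def symmetric_series_def)
qed

lemma rename_esym:
  fixes \<sigma> :: "'v \<Rightarrow> 'w"
  assumes "bij \<sigma>"
  shows "rename \<sigma> (esym k) = esym k"
proof (rule series_eqI)
  fix N
  obtain M where N: "N = image_mset \<sigma> M" using image_mset_surj[OF assms] by blast
  have inj: "inj_on \<sigma> A" for A using assms by (meson bij_is_inj inj_on_subset top_greatest)
  have "(\<exists>S. finite S \<and> card S = k \<and> M = mset_set S) \<longleftrightarrow>
      (\<exists>T. finite T \<and> card T = k \<and> N = mset_set T)"
  proof
    assume "\<exists>S. finite S \<and> card S = k \<and> M = mset_set S"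
    then obtain S where "finite S" "card S = k" "M = mset_set S" by blast
    then show "\<exists>T. finite T \<and> card T = k \<and> N = mset_set T"
      using N inj by (intro exI[of _ "\<sigma> ` S"]) (simp add: card_image image_mset_mset_set)
  next
    assume "\<exists>T. finite T \<and> card T = k \<and> N = mset_set T"
    then obtain T where T: "finite T" "card T = k" "N = mset_set T" by blast
    obtain S where S: "T = \<sigma> ` S" using assms by (metis bij_is_surj subset_UNIV subset_imageE)
    have "finite S" using T S inj finite_imageD by blast
    moreover have "image_mset \<sigma> M = image_mset \<sigma> (mset_set S)"
      using N S T inj by (simp add: image_mset_mset_set)
    ultimately show "\<exists>S. finite S \<and> card S = k \<and> M = mset_set S"
      using T S inj image_mset_inj[OF bij_is_inj[OF assms]] by (metis card_image)
  qed
  then show "mcoeff (rename \<sigma> (esym k)) N = mcoeff (esym k) N"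
    using mcoeff_rename_inj[OF bij_is_inj[OF assms], of "esym k" M] N by (simp add: mcoeff_esym)
qed

lemma rename_mult:
  assumes "bij \<sigma>"
  shows "rename \<sigma> (f * g) = rename \<sigma> f * rename \<sigma> g"
proof (rule series_eqI)
  fix N
  obtain M where N: "N = image_mset \<sigma> M" using image_mset_surj[OF assms] by blast
  note inj = bij_is_inj[OF assms]
  have sub: "{B. B \<subseteq># N} = image_mset \<sigma> ` {A. A \<subseteq># M}"
  proof (intro equalityI subsetI)
    fix B assume "B \<in> {B. B \<subseteq># N}"
    then obtain C where C: "N = B + C" by (auto simp: mset_subset_eq_exists_conv)
    obtain A A' where "B = image_mset \<sigma> A" "C = image_mset \<sigma> A'"
      using image_mset_surj[OF assms] by metis
    with C N have "M = A + A'" "B = image_mset \<sigma> A"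
      using image_mset_inj[OF inj, of M "A + A'"] by auto
    then show "B \<in> image_mset \<sigma> ` {A. A \<subseteq># M}" by auto
  qed (auto simp: N image_mset_subseteq_mono)
  have "mcoeff (rename \<sigma> f * rename \<sigma> g) N = (\<Sum>A | A \<subseteq># M.
      mcoeff (rename \<sigma> f) (image_mset \<sigma> A) * mcoeff (rename \<sigma> g) (N - image_mset \<sigma> A))"
    unfolding times_series.rep_eq sub
    by (subst sum.reindex) (auto intro: inj_onI image_mset_inj[OF inj])
  also have "\<dots> = (\<Sum>A | A \<subseteq># M. mcoeff f A * mcoeff g (M - A))"
  proof (rule sum.cong)
    fix A assume "A \<in> {A. A \<subseteq># M}"
    then have "N - image_mset \<sigma> A = image_mset \<sigma> (M - A)" by (simp add: N image_mset_Diff)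
    then show "mcoeff (rename \<sigma> f) (image_mset \<sigma> A) * mcoeff (rename \<sigma> g) (N - image_mset \<sigma> A)
        = mcoeff f A * mcoeff g (M - A)"
      by (simp add: mcoeff_rename_inj[OF inj])
  qed simp
  also have "\<dots> = mcoeff (rename \<sigma> (f * g)) N"
    by (simp add: N mcoeff_rename_inj[OF inj] times_series.rep_eq)
  finally show "mcoeff (rename \<sigma> (f * g)) N = mcoeff (rename \<sigma> f * rename \<sigma> g) N" ..
qed

lemma rename_sum: "rename \<sigma> (\<Sum>x\<in>A. f x) = (\<Sum>x\<in>A. rename \<sigma> (f x))"
proof -
  have zero: "rename \<sigma> 0 = 0" by transfer simp
  have add: "rename \<sigma> (g + h) = rename \<sigma> g + rename \<sigma> h" for g h
    by transfer (simp add: sum.distrib)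
  show ?thesis by (induction A rule: infinite_finite_induct) (auto simp: zero add)
qed

lemma rename_Some_esym:
  "mcoeff (rename Some (esym k)) N =
    (if None \<notin># N \<and> (\<exists>T. finite T \<and> card T = k \<and> N = mset_set T) then 1 else 0)"
proof (cases "None \<in># N")
  case True
  then have "{M. image_mset Some M = N} = {}" by auto
  then show ?thesis using True by (simp add: rename.rep_eq)
next
  case False
  define M where "M = image_mset the N"
  have "image_mset Some M = image_mset (\<lambda>x. x) N"
    unfolding M_def multiset.map_comp using False
    by (intro image_mset_cong) (metis comp_apply option.collapse)
  then have N: "N = image_mset Some M" by simp
  have "(\<exists>S. finite S \<and> card S = k \<and> M = mset_set S) \<longleftrightarrow>
      (\<exists>T. finite T \<and> card T = k \<and> N = mset_set T)"
  proof
    assume "\<exists>S. finite S \<and> card S = k \<and> M = mset_set S"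
    then obtain S where "finite S" "card S = k" "M = mset_set S" by blast
    then show "\<exists>T. finite T \<and> card T = k \<and> N = mset_set T"
      using N by (intro exI[of _ "Some ` S"]) (simp add: card_image image_mset_mset_set)
  next
    assume "\<exists>T. finite T \<and> card T = k \<and> N = mset_set T"
    then obtain T where T: "finite T" "card T = k" "N = mset_set T" by blast
    have "inj_on the T" using T False by (intro inj_onI option.expand) auto
    then show "\<exists>S. finite S \<and> card S = k \<and> M = mset_set S"
      using T by (intro exI[of _ "the ` T"]) (simp add: M_def card_image image_mset_mset_set)
  qed
  then show ?thesis
    using False mcoeff_rename_inj[of Some "esym k" M] N by (simp add: mcoeff_esym)
qed

lemma eval_plus_esym:
  assumes "k \<ge> 1"
  shows "eval_plus (esym k) = rename Some (esym k) + rename Some (esym (k - 1)) * var None"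
proof (rule series_eqI)
  fix N :: "nat option multiset"
  obtain l where k: "k = Suc l" using assms by (cases k) auto
  show "mcoeff (eval_plus (esym k)) N =
      mcoeff (rename Some (esym k) + rename Some (esym (k - 1)) * var None) N"
  proof (cases "None \<in># N")
    case False
    then show ?thesis
      by (simp add: eval_plus_def rename_esym bij_case_nat_option plus_series.rep_eq mult.commute
          mcoeff_var_mult rename_Some_esym mcoeff_esym)
  next
    case True
    then obtain N' where N: "N = add_mset None N'" by (metis multi_member_split)
    have "(\<exists>T. finite T \<and> card T = k \<and> N = mset_set T) \<longleftrightarrow>
        None \<notin># N' \<and> (\<exists>T. finite T \<and> card T = l \<and> N' = mset_set T)"
    proof
      assume "\<exists>T. finite T \<and> card T = k \<and> N = mset_set T"
      then obtain T where T: "finite T" "card T = k" "N = mset_set T" by blast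
      have "None \<in> T" using T True by simp
      then have "N = add_mset None (mset_set (T - {None}))" "card (T - {None}) = l"
        using T k by (metis mset_set.remove, simp)
      then show "None \<notin># N' \<and> (\<exists>T. finite T \<and> card T = l \<and> N' = mset_set T)"
        using N T by auto
    next
      assume "None \<notin># N' \<and> (\<exists>T. finite T \<and> card T = l \<and> N' = mset_set T)"
      then obtain T where T: "None \<notin># N'" "finite T" "card T = l" "N' = mset_set T" by blast
      then have "None \<notin> T" by simp
      with T show "\<exists>T. finite T \<and> card T = k \<and> N = mset_set T"
        using k N by (intro exI[of _ "insert None T"]) simp
    qed
    then show ?thesis
      using True N k
      by (simp add: eval_plus_def rename_esym bij_case_nat_option plus_series.rep_eq
          mult.commute[of _ "var None"] mcoeff_var_mult rename_Some_esym mcoeff_esym)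
  qed
qed


section \<open>Schroeder and Dyck paths\<close>

datatype step = Up | Diag | Right

fun step_vec :: "step \<Rightarrow> nat \<times> nat" where
  "step_vec Up = (0, 1)"
| "step_vec Diag = (1, 1)"
| "step_vec Right = (1, 0)"

definition schroeder_paths :: "nat \<Rightarrow> nat \<Rightarrow> (nat \<times> nat) list set" where
  "schroeder_paths m n = {\<alpha>. \<alpha> \<noteq> [] \<and> hd \<alpha> = (0, 0) \<and> last \<alpha> = (m, n) \<and>
     (\<forall>(u, v) \<in> set \<alpha>. int m * int v - int n * int u \<ge> 0) \<and>
     successively (\<lambda>p q. \<exists>s. q = p + step_vec s) \<alpha>}"

definition steps :: "(nat \<times> nat) list \<Rightarrow> step list" where
  "steps \<alpha> = map2 (\<lambda>p q. THE s. q = p + step_vec s) \<alpha> (tl \<alpha>)"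

definition diag :: "(nat \<times> nat) list \<Rightarrow> nat" where
  "diag \<alpha> = count_list (steps \<alpha>) Diag"

function up_runs :: "step list \<Rightarrow> nat list" where
  "up_runs [] = []"
| "up_runs (s # ss) =
    (if s = Up then length (takeWhile ((=) Up) (s # ss)) # up_runs (dropWhile ((=) Up) ss)
     else up_runs ss)"
  by pat_completeness auto
termination
  by (relation "measure length") (auto simp: le_imp_less_Suc length_dropWhile_le)

definition risers :: "(nat \<times> nat) list \<Rightarrow> nat list" where
  "risers \<alpha> = up_runs (steps \<alpha>)"

definition dyck_paths :: "nat \<Rightarrow> nat \<Rightarrow> (nat \<times> nat) list set" where
  "dyck_paths m n = {\<alpha> \<in> schroeder_paths m n. diag \<alpha> = 0}"

lemma step_vec_inject: "step_vec s = step_vec t \<Longrightarrow> s = t"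
  by (cases s; cases t) auto

lemma steps_Cons_Cons: "steps (p # (p + step_vec s) # \<alpha>) = s # steps ((p + step_vec s) # \<alpha>)"
  by (auto simp: steps_def dest: step_vec_inject intro!: the_equality)

text \<open>The sums over paths below are finite.\<close>

lemma finite_schroeder_paths: "finite (schroeder_paths m n)"
proof -
  let ?R = "\<lambda>p q :: nat \<times> nat. \<exists>s. q = p + step_vec s"
  have "set \<alpha> \<subseteq> {..m} \<times> {..n} \<and> length \<alpha> \<le> m + n + 1 - (fst (hd \<alpha>) + snd (hd \<alpha>))
      \<and> fst (hd \<alpha>) + snd (hd \<alpha>) \<le> m + n"
    if "\<alpha> \<noteq> []" "last \<alpha> = (m, n)" "successively ?R \<alpha>" for \<alpha>
    using that
  proof (induction \<alpha>)
    case (Cons p \<alpha>)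
    show ?case
    proof (cases "\<alpha> = []")
      case False
      then obtain s where s: "hd \<alpha> = p + step_vec s"
        using Cons.prems by (auto simp: successively_Cons)
      have IH: "set \<alpha> \<subseteq> {..m} \<times> {..n}"
        "length \<alpha> \<le> m + n + 1 - (fst (hd \<alpha>) + snd (hd \<alpha>))"
        "fst (hd \<alpha>) + snd (hd \<alpha>) \<le> m + n"
        using Cons False by (auto simp: successively_Cons)
      have "hd \<alpha> \<in> {..m} \<times> {..n}" using IH(1) False by (meson hd_in_set subsetD)
      then show ?thesis using IH s by (cases s; cases p) auto
    qed (use Cons.prems in auto)
  qed simp
  then have "schroeder_paths m n \<subseteq>
      {\<alpha>. set \<alpha> \<subseteq> {..m} \<times> {..n} \<and> length \<alpha> \<le> m + n + 1}"
    unfolding schroeder_paths_def by fastforce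
  then show ?thesis
    by (rule finite_subset) (rule finite_lists_length_le, simp)
qed


section \<open>Symmetric function enumerators\<close>

definition path_weight :: "(nat \<times> nat) list \<Rightarrow> nat series" where
  "path_weight \<alpha> = prod_list (map esym (risers \<alpha>))"

definition schroeder_enum :: "nat \<Rightarrow> nat \<Rightarrow> nat option series" where
  "schroeder_enum m n =
    (\<Sum>\<alpha>\<in>schroeder_paths m n. rename Some (path_weight \<alpha>) * var None ^ diag \<alpha>)"

definition dyck_enum :: "nat \<Rightarrow> nat \<Rightarrow> nat series" where
  "dyck_enum m n = (\<Sum>\<alpha>\<in>dyck_paths m n. path_weight \<alpha>)"

lemma symmetric_dyck_enum: "symmetric_series (dyck_enum m n)"
  unfolding symmetric_series_def
proof (intro allI impI)
  fix \<pi> :: "nat \<Rightarrow> nat" assume \<pi>: "bij \<pi>"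
  have "rename \<pi> (prod_list (map esym ks)) = prod_list (map esym ks)" for ks
    by (induction ks) (simp_all add: \<pi> rename_mult rename_esym rename_esym[of \<pi> 0, simplified])
  then show "rename \<pi> (dyck_enum m n) = dyck_enum m n"
    by (simp add: dyck_enum_def path_weight_def rename_sum)
qed

end

theory Submission
  imports Defs
begin

text \<open>
  Encode a path by its word of steps. Replacing every diagonal step by an up step followed by a
  right step turns a Schroeder path into a Dyck path: the endpoint is unchanged, and each new
  point lies directly above an old one, hence on the correct side of the diagonal
  (\<open>open_diags_mem_schroeder_words_iff\<close>). Conversely, the Schroeder paths over a given Dyck
  path arise by choosing some of its peaks (up step followed by right step) and cutting each of
  them by a diagonal step.

  Since \<open>(m, n)\<close> lies on the diagonal and \<open>m > 0\<close>, a Dyck path cannot end with an up step. So each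
  of its risers, of length \<open>k\<close> say, ends in exactly one peak. Leaving the peak alone contributes
  \<open>e\<^sub>k(x)\<close>, and cutting it contributes \<open>e\<^bsub>k-1\<^esub>(x) y\<close> (for \<open>k = 1\<close> the riser
  disappears, which agrees with \<open>e\<^sub>0 = 1\<close>); the choices are independent, and the two
  contributions add up to \<open>e\<^sub>k(x + y)\<close>. Hence the Schroeder paths over a Dyck path have total weight
  equal to the weight of the Dyck path evaluated at \<open>x + y\<close> (\<open>sum_run_weight_open_diags\<close>), and
  summing over all Dyck paths gives the theorem.
\<close>

section \<open>Injective renamings are multiplicative\<close>

text \<open>
  Multiplicativity is needed for the inclusion \<open>Some\<close> of the old variables, which is not onto. If
  \<open>N\<close> involves a variable outside the range of \<open>\<sigma>\<close>, then so does one factor of every splitting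
  of \<open>N\<close>, and both sides have coefficient 0 there.
\<close>

lemma rename_mult_inj:
  assumes inj: "inj \<sigma>"
  shows "rename \<sigma> (f * g) = rename \<sigma> f * rename \<sigma> g"
proof (rule series_eqI)
  fix N
  show "mcoeff (rename \<sigma> (f * g)) N = mcoeff (rename \<sigma> f * rename \<sigma> g) N"
  proof (cases "\<exists>M. N = image_mset \<sigma> M")
    case False
    then have none: "{M. image_mset \<sigma> M = N} = {}" by blast
    have "mcoeff (rename \<sigma> f) A * mcoeff (rename \<sigma> g) (N - A) = 0" if "A \<subseteq># N" for A
    proof (rule ccontr)
      assume nz: "mcoeff (rename \<sigma> f) A * mcoeff (rename \<sigma> g) (N - A) \<noteq> 0"
      then have "{M. image_mset \<sigma> M = A} \<noteq> {}" "{M. image_mset \<sigma> M = N - A} \<noteq> {}"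
        unfolding rename.rep_eq by (metis mult_zero_left sum.empty, metis mult_zero_right sum.empty)
      then obtain B C where "image_mset \<sigma> B = A" "image_mset \<sigma> C = N - A" by blast
      then have "N = image_mset \<sigma> (B + C)"
        using that by (metis image_mset_union subset_mset.add_diff_inverse)
      then show False using False by blast
    qed
    then have "mcoeff (rename \<sigma> f * rename \<sigma> g) N = 0"
      unfolding times_series.rep_eq by (intro sum.neutral) blast
    then show ?thesis by (simp only: rename.rep_eq none sum.empty)
  next
    case True
    then obtain M where N: "N = image_mset \<sigma> M" by blast
    have sub: "{B. B \<subseteq># N} = image_mset \<sigma> ` {A. A \<subseteq># M}"
    proof (intro equalityI subsetI)
      fix B assume "B \<in> {B. B \<subseteq># N}"
      then obtain C where "image_mset \<sigma> M = B + C" by (auto simp: N mset_subset_eq_exists_conv)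
      then obtain A A' where "M = A + A'" "B = image_mset \<sigma> A"
        using image_mset_eq_plusD by blast
      then show "B \<in> image_mset \<sigma> ` {A. A \<subseteq># M}" by auto
    qed (auto simp: N image_mset_subseteq_mono)
    have "mcoeff (rename \<sigma> f * rename \<sigma> g) N = (\<Sum>A | A \<subseteq># M.
        mcoeff (rename \<sigma> f) (image_mset \<sigma> A) * mcoeff (rename \<sigma> g) (N - image_mset \<sigma> A))"
      unfolding times_series.rep_eq sub
      by (subst sum.reindex) (auto intro: inj_onI image_mset_inj[OF inj])
    also have "\<dots> = (\<Sum>A | A \<subseteq># M. mcoeff f A * mcoeff g (M - A))"
      by (rule sum.cong)
        (simp_all add: N mcoeff_rename_inj[OF inj] flip: image_mset_Diff)
    also have "\<dots> = mcoeff (rename \<sigma> (f * g)) N"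
      by (simp add: N mcoeff_rename_inj[OF inj] times_series.rep_eq)
    finally show ?thesis ..
  qed
qed

lemma rename_one: "rename \<sigma> 1 = 1"
proof (rule series_eqI)
  fix N
  have "{M. image_mset \<sigma> M = {#}} = {{#}}" by auto
  then show "mcoeff (rename \<sigma> 1) N = mcoeff 1 N"
    by (cases "N = {#}") (auto simp: rename.rep_eq one_series.rep_eq intro!: sum.neutral)
qed

lemma rename_prod_list:
  assumes "inj \<sigma>"
  shows "rename \<sigma> (prod_list fs) = prod_list (map (rename \<sigma>) fs)"
  by (induction fs) (simp_all add: rename_one rename_mult_inj[OF assms])

section \<open>Paths as words\<close>

fun walk :: "nat \<times> nat \<Rightarrow> step list \<Rightarrow> (nat \<times> nat) list" where
  "walk p [] = [p]"
| "walk p (s # ss) = p # walk (p + step_vec s) ss"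

lemma walk_not_Nil [simp]: "walk p w \<noteq> []"
  by (cases w) auto

lemma hd_walk [simp]: "hd (walk p w) = p"
  by (cases w) auto

lemma successively_walk: "successively (\<lambda>p q. \<exists>s. q = p + step_vec s) (walk p w)"
  by (induction w arbitrary: p) (auto simp: successively_Cons)

lemma steps_walk [simp]: "steps (walk p w) = w"
proof (induction w arbitrary: p)
  case Nil
  show ?case by (simp add: steps_def)
next
  case (Cons s w)
  obtain \<alpha> where "walk (p + step_vec s) w = (p + step_vec s) # \<alpha>"
    by (cases w) auto
  then show ?case using Cons.IH[of "p + step_vec s"] by (simp add: steps_Cons_Cons)
qed

lemma walk_steps:
  assumes "\<alpha> \<noteq> []" "successively (\<lambda>p q. \<exists>s. q = p + step_vec s) \<alpha>"
  shows "walk (hd \<alpha>) (steps \<alpha>) = \<alpha>"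
  using assms
proof (induction \<alpha> rule: induct_list012)
  case (2 p)
  show ?case by (simp add: steps_def)
next
  case (3 p q \<alpha>)
  then obtain s where "q = p + step_vec s" by auto
  with 3 show ?case by (simp add: steps_Cons_Cons)
qed simp

lemma walk_snoc: "walk p (w @ [s]) = walk p w @ [last (walk p w) + step_vec s]"
  by (induction w arbitrary: p) auto

definition schroeder_words :: "nat \<Rightarrow> nat \<Rightarrow> step list set" where
  "schroeder_words m n = {w. walk (0, 0) w \<in> schroeder_paths m n}"

lemma bij_betw_steps: "bij_betw steps (schroeder_paths m n) (schroeder_words m n)"
proof (rule bij_betw_byWitness[where f' = "walk (0, 0)"])
  show "\<forall>\<alpha>\<in>schroeder_paths m n. walk (0, 0) (steps \<alpha>) = \<alpha>"
    unfolding schroeder_paths_def using walk_steps by force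
  then show "steps ` schroeder_paths m n \<subseteq> schroeder_words m n"
    by (auto simp: schroeder_words_def)
qed (auto simp: schroeder_words_def)

text \<open>
  The endpoint lies on the diagonal, so for \<open>m > 0\<close> the point below it is out of bounds. This is
  what provides every riser with a peak.
\<close>

lemma last_schroeder_word:
  assumes "m > 0" "w \<in> schroeder_words m n" "w \<noteq> []"
  shows "last w \<noteq> Up"
proof
  assume "last w = Up"
  then obtain w' where w: "w = w' @ [Up]" using assms(3) by (metis append_butlast_last_id)
  obtain u v where uv: "last (walk (0, 0) w') = (u, v)" by fastforce
  then have "(u, v) \<in> set (walk (0, 0) w)"
    using last_in_set[OF walk_not_Nil, of "(0, 0)" w'] by (simp add: w walk_snoc)
  then have "int m * int v - int n * int u \<ge> 0"
    using assms(2) by (auto simp: schroeder_words_def schroeder_paths_def)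
  moreover have "u = m" "n = Suc v"
    using assms(2) uv by (auto simp: schroeder_words_def schroeder_paths_def w walk_snoc)
  ultimately show False using assms(1) by (simp add: algebra_simps)
qed

section \<open>Opening diagonal steps\<close>

fun open_diags :: "step list \<Rightarrow> step list" where
  "open_diags [] = []"
| "open_diags (Diag # w) = Up # Right # open_diags w"
| "open_diags (Up # w) = Up # open_diags w"
| "open_diags (Right # w) = Right # open_diags w"

lemma Diag_notin_open_diags: "Diag \<notin> set (open_diags w)"
  by (induction w rule: open_diags.induct) auto

lemma last_walk_open_diags: "last (walk p (open_diags w)) = last (walk p w)"
  by (induction w arbitrary: p rule: open_diags.induct) (auto simp: add.assoc)

text \<open>
  Each point gained by opening a diagonal step is the upper neighbour of a point of the original
  walk, so it satisfies any condition that is stable under going up.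
\<close>

lemma walk_open_diags_Ball_iff:
  assumes up: "\<And>p. P p \<Longrightarrow> P (p + (0, 1))"
  shows "(\<forall>q\<in>set (walk p (open_diags w)). P q) \<longleftrightarrow> (\<forall>q\<in>set (walk p w). P q)"
proof (induction w arbitrary: p rule: open_diags.induct)
  case (2 w)
  have "p + (0, 1) + (1, 0) = p + (1, 1)" by (simp add: add.assoc)
  then show ?case using 2[of "p + (1, 1)"] up[of p] by auto
qed auto

lemma open_diags_mem_schroeder_words_iff:
  "open_diags w \<in> schroeder_words m n \<longleftrightarrow> w \<in> schroeder_words m n"
proof -
  let ?P = "\<lambda>(u, v). int m * int v - int n * int u \<ge> 0"
  have "?P (p + (0, 1))" if "?P p" for p
    using that by (cases p) (simp add: algebra_simps)
  then have "(\<forall>q\<in>set (walk (0, 0) (open_diags w)). ?P q) \<longleftrightarrow> (\<forall>q\<in>set (walk (0, 0) w). ?P q)"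
    by (rule walk_open_diags_Ball_iff)
  then show ?thesis
    by (simp add: schroeder_words_def schroeder_paths_def last_walk_open_diags successively_walk)
qed

lemma open_diags_eq_Nil_iff [simp]: "open_diags s = [] \<longleftrightarrow> s = []"
  by (cases s rule: open_diags.cases) auto

lemma open_diags_eq_Right_iff:
  "open_diags s = Right # w \<longleftrightarrow> (\<exists>t. s = Right # t \<and> open_diags t = w)"
  by (cases s rule: open_diags.cases) auto

lemma open_diags_eq_Up_iff:
  "open_diags s = Up # w \<longleftrightarrow> (\<exists>t. s = Up # t \<and> open_diags t = w) \<or>
    (\<exists>t. s = Diag # t \<and> w = Right # open_diags t)"
  by (cases s rule: open_diags.cases) auto

lemma length_le_open_diags: "length w \<le> length (open_diags w)"
  by (induction w rule: open_diags.induct) auto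

lemma finite_open_diags_fibre: "finite {s. open_diags s = w}"
proof (rule finite_subset)
  have "set s \<subseteq> {Up, Diag, Right}" for s by (auto intro: step.exhaust)
  then show "{s. open_diags s = w} \<subseteq> {s. set s \<subseteq> {Up, Diag, Right} \<and> length s \<le> length w}"
    using length_le_open_diags by auto
qed (simp add: finite_lists_length_le)

section \<open>Weights of words\<close>

text \<open>
  The weight of a word preceded by \<open>a\<close> up steps, where \<open>e k\<close> stands for \<open>e\<^sub>k\<close>. Keeping the length
  of the current riser as an argument makes the weight structurally recursive; \<open>e 0\<close> occurs for
  an empty riser, so \<open>e 0 = 1\<close> is the intended case.
\<close>

fun run_weight :: "(nat \<Rightarrow> 'a) \<Rightarrow> 'a \<Rightarrow> nat \<Rightarrow> step list \<Rightarrow> 'a::comm_semiring_1" where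
  "run_weight e y a [] = e a"
| "run_weight e y a (Up # w) = run_weight e y (Suc a) w"
| "run_weight e y a (Diag # w) = e a * y * run_weight e y 0 w"
| "run_weight e y a (Right # w) = e a * run_weight e y 0 w"

lemma run_weight_takeWhile:
  assumes "e 0 = 1"
  shows "run_weight e y a w =
    e (a + length (takeWhile ((=) Up) w)) * run_weight e y 0 (dropWhile ((=) Up) w)"
proof (induction w arbitrary: a)
  case (Cons s w)
  then show ?case by (cases s) (simp_all add: assms mult.assoc)
qed (simp add: assms)

lemma count_list_dropWhile_Up:
  "count_list (dropWhile ((=) Up) w) Diag = count_list w Diag"
  by (induction w) auto

lemma run_weight_eq_prod_up_runs:
  assumes "e 0 = 1"
  shows "run_weight e y 0 w = prod_list (map e (up_runs w)) * y ^ count_list w Diag"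
proof (induction w rule: up_runs.induct)
  case 1
  show ?case using assms by simp
next
  case (2 s w)
  show ?case
  proof (cases s)
    case Up
    then show ?thesis
      using 2(1) run_weight_takeWhile[of e y "Suc 0" w, OF assms]
      by (simp add: count_list_dropWhile_Up mult.assoc)
  qed (use 2(2) assms in \<open>simp_all add: mult_ac\<close>)
qed

text \<open>
  The words over \<open>w\<close> are obtained by cutting some of its peaks. A riser of length \<open>a + 1\<close> followed
  by a right step contributes \<open>e (a + 1)\<close> if its peak is kept and \<open>e a * y\<close> if it is cut, in total
  \<open>e' (a + 1)\<close>. The induction moves up steps into the argument \<open>a\<close>, so at least one up step must
  remain visible in \<open>w\<close> as long as the current riser is nonempty: otherwise its peak would be lost.
  This is the alternative in the last hypothesis.
\<close>

lemma sum_run_weight_open_diags: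
  fixes e e' :: "nat \<Rightarrow> 'a::comm_semiring_1"
  assumes e0: "e 0 = 1" "e' 0 = 1" and e_Suc: "\<And>k. e' (Suc k) = e (Suc k) + e k * y"
    and "Diag \<notin> set w" "w \<noteq> [] \<Longrightarrow> last w \<noteq> Up" "a = 0 \<or> (\<exists>v. w = Up # v)"
  shows "(\<Sum>s | open_diags s = w. run_weight e y a s) = run_weight e' y a w"
  using assms(4-)
proof (induction w arbitrary: a rule: induct_list012)
  case 1
  then show ?case by (simp add: e0)
next
  case (2 s)
  then have "s = Right" "a = 0" by (cases s; auto)+
  moreover have "{s. open_diags s = [Right]} = {[Right]}"
    by (auto simp: open_diags_eq_Right_iff)
  ultimately show ?case by (simp add: e0)
next
  case (3 s t w)
  have fib_Right: "{s. open_diags s = Right # v} = (#) Right ` {s. open_diags s = v}" for v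
    by (auto simp: open_diags_eq_Right_iff)
  show ?case
  proof (cases s)
    case Right
    then have "a = 0" using "3.prems" by auto
    then show ?thesis
      using 3 Right
      by (simp add: fib_Right sum.reindex e0)
  next
    case Up
    show ?thesis
    proof (cases t)
      case t: Up
      have "{s. open_diags s = Up # Up # w} = (#) Up ` {s. open_diags s = Up # w}"
        by (auto simp: open_diags_eq_Up_iff)
      then show ?thesis
        using 3 Up t by (simp add: sum.reindex)
    next
      case t: Right
      let ?F = "{s. open_diags s = w}"
      have "{s. open_diags s = Up # Right # w} =
          (\<lambda>s. Up # Right # s) ` ?F \<union> (#) Diag ` ?F"
        by (auto simp: open_diags_eq_Up_iff open_diags_eq_Right_iff)
      moreover have "(\<lambda>s. Up # Right # s) ` ?F \<inter> (#) Diag ` ?F = {}" by auto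
      ultimately have "(\<Sum>s | open_diags s = Up # Right # w. run_weight e y a s) =
          (\<Sum>s\<in>?F. run_weight e y a (Up # Right # s)) + (\<Sum>s\<in>?F. run_weight e y a (Diag # s))"
        using finite_open_diags_fibre[of w]
        by (simp add: sum.union_disjoint sum.reindex inj_on_def)
      also have "\<dots> = (e (Suc a) + e a * y) * (\<Sum>s\<in>?F. run_weight e y 0 s)"
        by (simp add: distrib_right flip: sum_distrib_left)
      also have "\<dots> = e' (Suc a) * run_weight e' y 0 w"
      proof -
        have "(\<Sum>s\<in>?F. run_weight e y 0 s) = run_weight e' y 0 w"
          using "3.prems" Up t by (intro "3.IH"(1)) auto
        then show ?thesis by (simp add: e_Suc)
      qed
      finally show ?thesis by (simp add: Up t)
    qed (use "3.prems" in auto)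
  qed (use "3.prems" in auto)
qed

section \<open>Comparing the enumerators\<close>

lemma schroeder_enum_words:
  "schroeder_enum m n =
    (\<Sum>w\<in>schroeder_words m n. run_weight (\<lambda>k. rename Some (esym k)) (var None) 0 w)"
proof -
  have "rename Some (path_weight \<alpha>) * var None ^ diag \<alpha> =
      run_weight (\<lambda>k. rename Some (esym k)) (var None) 0 (steps \<alpha>)" for \<alpha>
    by (simp add: run_weight_eq_prod_up_runs rename_one path_weight_def risers_def diag_def
        rename_prod_list comp_def)
  then show ?thesis
    unfolding schroeder_enum_def
    using sum.reindex_bij_betw[OF bij_betw_steps,
        of "run_weight (\<lambda>k. rename Some (esym k)) (var None) 0" m n]
    by simp
qed

lemma eval_plus_dyck_enum_words:
  "eval_plus (dyck_enum m n) = (\<Sum>w\<in>{w \<in> schroeder_words m n. Diag \<notin> set w}.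
    run_weight (\<lambda>k. eval_plus (esym k)) (var None) 0 w)"
proof -
  let ?f = "run_weight (\<lambda>k. eval_plus (esym k)) (var None) 0"
  have inj: "inj (case_nat None Some)" by (rule bij_is_inj[OF bij_case_nat_option])
  have diag: "diag \<alpha> = 0 \<longleftrightarrow> Diag \<notin> set (steps \<alpha>)" for \<alpha>
    by (simp add: diag_def count_list_0_iff)
  have "bij_betw steps (dyck_paths m n) {w \<in> schroeder_words m n. Diag \<notin> set w}"
    using bij_betw_steps[of m n] unfolding dyck_paths_def diag bij_betw_def
    by (auto intro: inj_on_subset)
  then have "(\<Sum>w\<in>{w \<in> schroeder_words m n. Diag \<notin> set w}. ?f w) =
      (\<Sum>\<alpha>\<in>dyck_paths m n. ?f (steps \<alpha>))"
    by (rule sum.reindex_bij_betw[symmetric])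
  also have "\<dots> = (\<Sum>\<alpha>\<in>dyck_paths m n. eval_plus (path_weight \<alpha>))"
  proof (rule sum.cong)
    fix \<alpha> assume "\<alpha> \<in> dyck_paths m n"
    then have "count_list (steps \<alpha>) Diag = 0" by (simp add: dyck_paths_def diag_def)
    then show "?f (steps \<alpha>) = eval_plus (path_weight \<alpha>)"
      by (simp add: run_weight_eq_prod_up_runs eval_plus_def rename_one path_weight_def
          risers_def rename_prod_list[OF inj] comp_def)
  qed simp
  finally show ?thesis by (simp add: dyck_enum_def eval_plus_def rename_sum)
qed

theorem corollary2:
  fixes m n :: nat
  assumes "m > 0" and "n > 0"
  shows "schroeder_enum m n = eval_plus (dyck_enum m n)"
proof -
  let ?S = "schroeder_words m n" and ?D = "{w \<in> schroeder_words m n. Diag \<notin> set w}"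
  let ?f = "run_weight (\<lambda>k. rename Some (esym k)) (var None) 0"
  let ?g = "run_weight (\<lambda>k. eval_plus (esym k)) (var None) 0"
  have fin: "finite ?S"
    using bij_betw_finite[OF bij_betw_steps] finite_schroeder_paths by blast
  have "(\<Sum>s\<in>?S. ?f s) = (\<Sum>w\<in>?D. \<Sum>s | s \<in> ?S \<and> open_diags s = w. ?f s)"
    using fin Diag_notin_open_diags
    by (intro sum.group[symmetric]) (auto simp: open_diags_mem_schroeder_words_iff)
  also have "\<dots> = (\<Sum>w\<in>?D. ?g w)"
  proof (rule sum.cong)
    fix w assume w: "w \<in> ?D"
    have "{s. s \<in> ?S \<and> open_diags s = w} = {s. open_diags s = w}"
      using w open_diags_mem_schroeder_words_iff by auto
    moreover have "(\<Sum>s | open_diags s = w. ?f s) = ?g w"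
      using w last_schroeder_word[OF assms(1), of w n]
      by (intro sum_run_weight_open_diags)
        (auto simp: rename_one eval_plus_def eval_plus_esym[unfolded eval_plus_def])
    ultimately show "(\<Sum>s | s \<in> ?S \<and> open_diags s = w. ?f s) = ?g w" by simp
  qed simp
  finally show ?thesis by (simp add: schroeder_enum_words eval_plus_dyck_enum_words)
qed

end
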